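(* Let $k\ge1$ and let $B_k$ be the unwrapped butterfly graph with $(k+1)2^k$ vertices. Counted with multiplicity, the eigenvalues of the Laplacian $L(B_k)=D-A$ of $B_k$ are exactly the following: <ul> <li>for $j=0,\dots,k$, the value $4-4\cos\!\left(\frac{\pi j}{k+1}\right)$, each with multiplicity $1$;</li> <li>for each $i=1,\dots,k$ and $j=0,\dots,i-1$, the value $4-4\cos\!\left(\frac{\pi(2j+1)}{2i+1}\right)$, with multiplicity $2^{k-i+1}$;</li> <li>for each $i=1,\dots,k-1$ and $j=1,\dots,i$, the value $4-4\cos\!\left(\frac{j\pi}{i+1}\right)$, with multiplicity $(k-i)2^{k-i-1}$.</li> </ul> Multiplicities of equal values arising from different items or indices are added.
   Context: The unwrapped butterfly graph $B_k$ is the undirected unweighted graph defined recursively. $B_0$ is a single vertex. $B_k$ consists of two disjoint copies of $B_{k-1}$, each with a last column of $2^{k-1}$ vertices $V_{k,j}$ and $V'_{k,j}$ ($j=1,\dots,2^{k-1}$), together with a new column of $2^k$ vertices $V_{k+1,j},V'_{k+1,j}$ ($j=1,\dots,2^{k-1}$). The new column is joined by the edges $\{V_{k,j},V_{k+1,j}\}$, $\{V'_{k,j},V'_{k+1,j}\}$, $\{V_{k,j},V'_{k+1,j}\}$ and $\{V'_{k,j},V_{k+1,j}\}$. Equivalently, $B_k$ has vertex set $\{(c,w): 0\le c\le k,\ w\in\{0,1\}^k\}$, and for each $1\le c\le k$ the vertex $(c-1,w)$ is adjacent to $(c,w)$ and to $(c,w\oplus e_c)$. $D$ is the degree matrix and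 $A$ the adjacency matrix of $B_k$. *)

theory Defs
  imports "Jordan_Normal_Form.Char_Poly" "HOL-Library.Multiset"
begin

text \<open>Unwrapped butterfly graph B_k. Vertices (c,w) with 0 <= c <= k and
  w < 2^k encoding a bit vector in {0,1}^k (bit c-1 of w is coordinate c).
  Vertex (c,w) is stored at matrix index c * 2^k + w.\<close>

definition bf_vertex :: "nat \<Rightarrow> nat \<Rightarrow> nat \<times> nat" where
  "bf_vertex k i = (i div 2^k, i mod 2^k)"

definition bf_size :: "nat \<Rightarrow> nat" where
  "bf_size k = (k + 1) * 2^k"

definition bf_adj :: "nat \<Rightarrow> nat \<times> nat \<Rightarrow> nat \<times> nat \<Rightarrow> bool" where
  "bf_adj k v v' = (case v of (c, w) \<Rightarrow> case v' of (c', w') \<Rightarrow>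
      c \<le> k \<and> c' \<le> k \<and> w < 2^k \<and> w' < 2^k \<and>
      ((c' = c + 1 \<and> (w' = w \<or> w' = flip_bit c w)) \<or>
       (c = c' + 1 \<and> (w = w' \<or> w = flip_bit c' w'))))"

definition bf_adj_mat :: "nat \<Rightarrow> real mat" where
  "bf_adj_mat k = mat (bf_size k) (bf_size k)
     (\<lambda>(i, j). if bf_adj k (bf_vertex k i) (bf_vertex k j) then 1 else 0)"

definition bf_deg_mat :: "nat \<Rightarrow> real mat" where
  "bf_deg_mat k = mat (bf_size k) (bf_size k)
     (\<lambda>(i, j). if i = j then (\<Sum>l < bf_size k. bf_adj_mat k $$ (i, l)) else 0)"

definition bf_laplacian :: "nat \<Rightarrow> real mat" where
  "bf_laplacian k = bf_deg_mat k - bf_adj_mat k"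

definition bf_spectrum :: "nat \<Rightarrow> real multiset" where
  "bf_spectrum k =
     mset (map (\<lambda>j. 4 - 4 * cos (pi * real j / real (k + 1))) [0..<k + 1])
   + (\<Sum>i\<in>{1..k}. \<Sum>j<i.
        replicate_mset (2 ^ (k - i + 1)) (4 - 4 * cos (pi * real (2 * j + 1) / real (2 * i + 1))))
   + (\<Sum>i\<in>{1..k - 1}. \<Sum>j\<in>{1..i}.
        replicate_mset ((k - i) * 2 ^ (k - i - 1)) (4 - 4 * cos (real j * pi / real (i + 1))))"

end

theory Submission
  imports Defs
begin

text \<open>
  Decompose functions on the vertices by the Walsh characters \<open>w \<mapsto> (-1)^(s \<bullet> w)\<close>. The two edges
  from \<open>(c, w)\<close> to column \<open>c + 1\<close> act on the component of frequency \<open>s\<close> as multiplication by 2 if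
  bit \<open>c\<close> of \<open>s\<close> is 0, and cancel otherwise. Hence the Laplacian splits into \<open>2^k\<close> tridiagonal
  matrices of size \<open>k + 1\<close> with diagonal \<open>2, 4, \<dots>, 4, 2\<close>, each cut into runs at the set bits of
  \<open>s\<close>. A run is the whole path, contains exactly one end column, or contains none; its
  characteristic polynomial is a Chebyshev-type polynomial whose roots are found by substituting
  \<open>x = 4 - 4 cos t\<close>. Counting in how many frequencies each run occurs gives the multiplicities.
\<close>

section \<open>Path polynomials and their roots\<close>

text \<open>Grouping by the lowest bit matches the recursion of \<open>segment_poly\<close>, which
  consumes a frequency from that end.\<close>

lemma prod_lessThan_power2_Suc:
  fixes f :: "nat \<Rightarrow> 'a :: comm_monoid_mult"
  shows "(\<Prod>s<2 ^ Suc n. f s) = (\<Prod>s<2 ^ n. f (2 * s) * f (2 * s + 1))"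
  using prod.nat_group[of f 2 "2 ^ n"]
  by (simp add: lessThan_atLeast0 mult.commute numeral_2_eq_2)

lemma sum_lessThan_power2_Suc:
  fixes f :: "nat \<Rightarrow> 'a :: comm_monoid_add"
  shows "(\<Sum>s<2 ^ Suc n. f s) = (\<Sum>s<2 ^ n. f (2 * s) + f (2 * s + 1))"
  using sum.nat_group[of f 2 "2 ^ n"]
  by (simp add: lessThan_atLeast0 mult.commute numeral_2_eq_2)

text \<open>Characteristic polynomial of an uncut run of columns: with \<open>p = x - 4\<close> of a run whose
  two ends are cut off, with \<open>p = x - 2\<close> of a run that contains column 0 and ends in a cut.\<close>

fun path_poly :: "real poly \<Rightarrow> nat \<Rightarrow> real poly" where
  "path_poly p 0 = 1"
| "path_poly p (Suc 0) = p"
| "path_poly p (Suc (Suc n)) = [:-4, 1:] * path_poly p (Suc n) - 4 * path_poly p n"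

text \<open>Scans the frequency \<open>s\<close> from its lowest bit, a set bit cutting the path; \<open>i\<close> is the
  length of the current run and \<open>n\<close> the number of columns still to come. The final
  \<open>+ 2 * path_poly p (i - 1)\<close> lowers the diagonal entry of the last column from 4 to 2.\<close>

fun segment_poly :: "real poly \<Rightarrow> nat \<Rightarrow> nat \<Rightarrow> nat \<Rightarrow> real poly" where
  "segment_poly p 0 i s = path_poly p i + 2 * path_poly p (i - 1)"
| "segment_poly p (Suc n) i s =
     (if even s then segment_poly p n (Suc i) (s div 2)
      else path_poly p i * segment_poly [:-4, 1:] n 1 (s div 2))"

text \<open>Both sides obey the same three-term recurrence, so two base cases suffice. The right
  side is what \<open>segment_poly\<close> yields for a run that starts after a cut and reaches the
  last column; it thus agrees with its mirror image, the run starting at column 0.\<close>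

lemma path_poly_end_eq:
  "path_poly [:-2, 1:] (Suc n) = path_poly [:-4, 1:] (Suc n) + 2 * path_poly [:-4, 1:] n"
proof (induction n rule: less_induct)
  case (less n)
  consider "n = 0" | "n = Suc 0" | m where "n = Suc (Suc m)"
    by (metis not0_implies_Suc)
  thus ?case
  proof cases
    case 1 thus ?thesis by (simp add: numeral_poly)
  next
    case 2 thus ?thesis by (simp add: numeral_poly)
  next
    case 3
    have rec: "path_poly p (Suc n) = [:-4, 1:] * path_poly p n - 4 * path_poly p (Suc m)"
      "path_poly p n = [:-4, 1:] * path_poly p (Suc m) - 4 * path_poly p m" for p
      using 3 by (simp_all only: path_poly.simps)
    have "path_poly [:-2, 1:] n = path_poly [:-4, 1:] n + 2 * path_poly [:-4, 1:] (Suc m)"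
      using less.IH[of "Suc m"] 3 by simp
    moreover have "path_poly [:-2, 1:] (Suc m) = path_poly [:-4, 1:] (Suc m) + 2 * path_poly [:-4, 1:] m"
      using less.IH[of m] 3 by simp
    ultimately have "path_poly [:-2, 1:] (Suc n) =
        [:-4, 1:] * (path_poly [:-4, 1:] n + 2 * path_poly [:-4, 1:] (Suc m)) -
        4 * (path_poly [:-4, 1:] (Suc m) + 2 * path_poly [:-4, 1:] m)"
      by (simp only: rec(1)[of "[:-2, 1:]"])
    also have "\<dots> = path_poly [:-4, 1:] (Suc n) +
        2 * ([:-4, 1:] * path_poly [:-4, 1:] (Suc m) - 4 * path_poly [:-4, 1:] m)"
      unfolding rec(1)[of "[:-4, 1:]"] by (simp only: algebra_simps)
    finally show ?thesis by (simp only: rec(2)[symmetric])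
  qed
qed

text \<open>The exponents count the bits left free by a run. The factors stand, in order, for the
  uncut path, the current run cut after \<open>l\<close> more columns, runs from a cut to the last
  column, and runs between two cuts. In the last case a run of length \<open>j + 1\<close> fixes
  \<open>j + 2\<close> bits and has \<open>n - 1 - j\<close> positions. The induction splits on the
  lowest bit; \<open>p\<close> and \<open>i\<close> vary because a cut resets them.\<close>

lemma prod_segment_poly:
  assumes "i \<ge> 1"
  shows "(\<Prod>s<2 ^ n. segment_poly p n i s) =
    (path_poly p (n + i) + 2 * path_poly p (n + i - 1)) *
    (\<Prod>l<n. path_poly p (i + l) ^ 2 ^ (n - 1 - l)) *
    (\<Prod>j<n. path_poly [:-2, 1:] (Suc j) ^ 2 ^ (n - 1 - j)) *
    (\<Prod>j<n. path_poly [:-4, 1:] (Suc j) ^ ((n - 1 - j) * 2 ^ (n - 1 - j - 1)))"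
  using assms
proof (induction n arbitrary: p i)
  case 0
  thus ?case by simp
next
  case (Suc n)
  define U where "U = path_poly [:-4, 1:]"
  define E where "E = path_poly [:-2, 1:]"
  define Z where "Z = path_poly p"
  have E_last: "U (Suc n) + 2 * U n = E (Suc n)"
    unfolding U_def E_def by (rule path_poly_end_eq[symmetric])
  \<comment> \<open>Both values of the lowest bit contribute the shorter end runs, doubling their
    exponents. The extra \<open>E (Suc n)\<close> is the run from the new cut to the end.\<close>
  have E2: "(\<Prod>j<Suc n. E (Suc j) ^ 2 ^ (n - j)) =
      E (Suc n) * ((\<Prod>j<n. E (Suc j) ^ 2 ^ (n - 1 - j)) * (\<Prod>j<n. E (Suc j) ^ 2 ^ (n - 1 - j)))"
  proof -
    have "E (Suc j) ^ 2 ^ (n - j) = E (Suc j) ^ 2 ^ (n - 1 - j) * E (Suc j) ^ 2 ^ (n - 1 - j)"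
      if "j < n" for j
    proof -
      have "n - j = Suc (n - 1 - j)" using that by simp
      thus ?thesis by (simp add: mult_2 power_add)
    qed
    hence "(\<Prod>j<n. E (Suc j) ^ 2 ^ (n - j)) =
      (\<Prod>j<n. E (Suc j) ^ 2 ^ (n - 1 - j) * E (Suc j) ^ 2 ^ (n - 1 - j))"
      by (intro prod.cong) auto
    thus ?thesis by (simp add: prod.distrib mult_ac)
  qed
  have U2: "(\<Prod>j<Suc n. U (Suc j) ^ ((n - j) * 2 ^ (n - j - 1))) =
      (\<Prod>l<n. U (1 + l) ^ 2 ^ (n - 1 - l)) *
      ((\<Prod>j<n. U (Suc j) ^ ((n - 1 - j) * 2 ^ (n - 1 - j - 1))) *
       (\<Prod>j<n. U (Suc j) ^ ((n - 1 - j) * 2 ^ (n - 1 - j - 1))))"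
  proof -
    have "U (Suc j) ^ ((n - j) * 2 ^ (n - j - 1)) = U (1 + j) ^ 2 ^ (n - 1 - j) *
        (U (Suc j) ^ ((n - 1 - j) * 2 ^ (n - 1 - j - 1)) * U (Suc j) ^ ((n - 1 - j) * 2 ^ (n - 1 - j - 1)))"
      if "j < n" for j
    proof -
      define d where "d = n - 1 - j"
      hence d: "n - 1 - j = d" "n - j = Suc d" using that by auto
      \<comment> \<open>The summand \<open>2 ^ d\<close> counts the runs beginning at the new cut.
        For \<open>d = 0\<close> the truncated \<open>d - 1\<close> is harmless, its coefficient
        being 0.\<close>
      have "Suc d * 2 ^ d = 2 ^ d + (d * 2 ^ (d - 1) + d * 2 ^ (d - 1))"
        by (cases d) auto
      thus ?thesis unfolding d by (simp add: power_add)
    qed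
    hence "(\<Prod>j<n. U (Suc j) ^ ((n - j) * 2 ^ (n - j - 1))) =
      (\<Prod>j<n. U (1 + j) ^ 2 ^ (n - 1 - j) *
        (U (Suc j) ^ ((n - 1 - j) * 2 ^ (n - 1 - j - 1)) * U (Suc j) ^ ((n - 1 - j) * 2 ^ (n - 1 - j - 1))))"
      by (intro prod.cong) auto
    thus ?thesis by (simp add: prod.distrib)
  qed
  have Z2: "(\<Prod>l<Suc n. Z (i + l) ^ 2 ^ (n - l)) = Z i ^ 2 ^ n * (\<Prod>l<n. Z (Suc i + l) ^ 2 ^ (n - 1 - l))"
    by (subst prod.lessThan_Suc_shift) simp
  have IH1: "(\<Prod>s<2 ^ n. segment_poly p n (Suc i) s) =
      (Z (n + Suc i) + 2 * Z (n + Suc i - 1)) * (\<Prod>l<n. Z (Suc i + l) ^ 2 ^ (n - 1 - l)) *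
      (\<Prod>j<n. E (Suc j) ^ 2 ^ (n - 1 - j)) *
      (\<Prod>j<n. U (Suc j) ^ ((n - 1 - j) * 2 ^ (n - 1 - j - 1)))"
    unfolding Z_def E_def U_def by (rule Suc.IH) simp
  have "(\<Prod>s<2 ^ n. segment_poly [:-4, 1:] n 1 s) =
      (U (n + 1) + 2 * U (n + 1 - 1)) * (\<Prod>l<n. U (1 + l) ^ 2 ^ (n - 1 - l)) *
      (\<Prod>j<n. E (Suc j) ^ 2 ^ (n - 1 - j)) *
      (\<Prod>j<n. U (Suc j) ^ ((n - 1 - j) * 2 ^ (n - 1 - j - 1)))"
    unfolding E_def U_def by (rule Suc.IH) simp
  also have "U (n + 1) + 2 * U (n + 1 - 1) = E (Suc n)" using E_last by simp
  finally have IH2: "(\<Prod>s<2 ^ n. segment_poly [:-4, 1:] n 1 s) =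
      E (Suc n) * (\<Prod>l<n. U (1 + l) ^ 2 ^ (n - 1 - l)) *
      (\<Prod>j<n. E (Suc j) ^ 2 ^ (n - 1 - j)) *
      (\<Prod>j<n. U (Suc j) ^ ((n - 1 - j) * 2 ^ (n - 1 - j - 1)))" .
  have "(\<Prod>s<2 ^ Suc n. segment_poly p (Suc n) i s) =
     (\<Prod>s<2 ^ n. segment_poly p n (Suc i) s * (Z i * segment_poly [:-4, 1:] n 1 s))"
    unfolding prod_lessThan_power2_Suc Z_def by simp
  also have "\<dots> = (\<Prod>s<2 ^ n. segment_poly p n (Suc i) s) * (Z i ^ 2 ^ n *
      (\<Prod>s<2 ^ n. segment_poly [:-4, 1:] n 1 s))"
    by (simp add: prod.distrib)
  also have "\<dots> = (Z (n + Suc i) + 2 * Z (n + Suc i - 1)) * (\<Prod>l<Suc n. Z (i + l) ^ 2 ^ (n - l)) *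
    (\<Prod>j<Suc n. E (Suc j) ^ 2 ^ (n - j)) * (\<Prod>j<Suc n. U (Suc j) ^ ((n - j) * 2 ^ (n - j - 1)))"
    unfolding IH1 IH2 E2 U2 Z2 by (simp only: mult_ac)
  finally show ?case by (simp add: U_def E_def Z_def)
qed

section \<open>Degrees and trigonometric roots of the path polynomials\<close>

lemma degree_path_poly:
  assumes "degree p = 1" "lead_coeff p = 1"
  shows "degree (path_poly p n) = n \<and> lead_coeff (path_poly p n) = 1"
proof (induction n rule: less_induct)
  case (less n)
  consider "n = 0" | "n = Suc 0" | m where "n = Suc (Suc m)"
    by (metis not0_implies_Suc)
  thus ?case
  proof cases
    case 1 thus ?thesis by simp
  next
    case 2 thus ?thesis using assms by simp
  next
    case 3
    let ?q = "path_poly p (Suc m)" and ?r = "4 * path_poly p m"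
    have q: "degree ?q = Suc m" "lead_coeff ?q = 1"
      using less.IH[of "Suc m"] 3 by auto
    have r: "degree ?r \<le> m"
      using less.IH[of m] 3 by (simp add: numeral_poly)
    have q0: "?q \<noteq> 0" using q by auto
    have d: "degree ([:-4, 1:] * ?q) = Suc (Suc m)"
      using q0 q by (subst degree_mult_eq) auto
    have l: "lead_coeff ([:-4, 1:] * ?q) = 1"
      using q by (subst lead_coeff_mult) auto
    have n: "path_poly p n = - ?r + [:-4, 1:] * ?q" using 3 by simp
    have lt: "degree (- ?r) < degree ([:-4, 1:] * ?q)" using r d by simp
    have "degree (path_poly p n) = n"
      unfolding n degree_add_eq_right[OF lt] using d 3 by simp
    moreover have "lead_coeff (path_poly p n) = 1"
      unfolding n using lead_coeff_add_le[OF lt] l by simp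
    ultimately show ?thesis by blast
  qed
qed

text \<open>Two monic polynomials of degree \<open>card I\<close> that agree at
  \<open>card I\<close> distinct points coincide: the leading coefficient replaces one evaluation
  point.\<close>

lemma monic_eq_prod_roots:
  fixes p :: "'a :: idom poly"
  assumes "inj_on f I" "finite I" "degree p = card I" "lead_coeff p = 1"
    and "\<And>i. i \<in> I \<Longrightarrow> poly p (f i) = 0"
  shows "p = (\<Prod>i\<in>I. [:- f i, 1:])"
proof (rule poly_eqI_degree_lead_coeff[where n = "card I" and A = "f ` I"])
  have d: "degree (\<Prod>i\<in>I. [:- f i, 1:]) = card I"
    by (subst degree_prod_sum_eq) auto
  have "lead_coeff (\<Prod>i\<in>I. [:- f i, 1:]) = 1"
    using assms(2) by (intro monic_prod) auto
  thus "poly.coeff p (card I) = poly.coeff (\<Prod>i\<in>I. [:- f i, 1:]) (card I)"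
    using assms d by simp
  show "degree (\<Prod>i\<in>I. [:- f i, 1:]) \<le> card I" using d by simp
  show "card I \<le> card (f ` I)" using assms by (simp add: card_image)
  show "degree p \<le> card I" using assms by simp
  show "poly p z = poly (\<Prod>i\<in>I. [:- f i, 1:]) z" if "z \<in> f ` I" for z
    using that assms by (auto simp: poly_prod prod_zero_iff)
qed

lemma sin_three_term:
  "sin (real (n + 2) * t) + sin (real n * t) = 2 * cos t * sin (real (n + 1) * t)"
  using sin_add[of "real (n + 1) * t" t] sin_diff[of "real (n + 1) * t" t]
  by (simp add: algebra_simps)

text \<open>At \<open>x = 4 - 4 * cos t\<close> the factor \<open>x - 4\<close> is
  \<open>- 4 * cos t\<close>, so dividing by \<open>(-2) ^ n\<close> turns the recurrence into that
  of the Chebyshev polynomials of the second kind. The factor \<open>sin t\<close> is kept on the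
  left to avoid dividing by zero.\<close>

lemma sin_mult_path_poly:
  "sin t * poly (path_poly [:-4, 1:] n) (4 - 4 * cos t) = (-2) ^ n * sin (real (n + 1) * t)"
proof (induction n rule: less_induct)
  case (less n)
  consider "n = 0" | "n = Suc 0" | m where "n = Suc (Suc m)"
    by (metis not0_implies_Suc)
  thus ?case
  proof cases
    case 1 thus ?thesis by simp
  next
    case 2 thus ?thesis by (simp add: sin_double)
  next
    case 3
    let ?x = "4 - 4 * cos t" and ?U = "path_poly [:-4, 1:]"
    have "sin (real (n + 1) * t) + sin (real (m + 1) * t) = 2 * cos t * sin (real (m + 2) * t)"
      using sin_three_term[of "Suc m" t] 3 by simp
    moreover have "sin t * poly (?U n) ?x =
        - 4 * cos t * (sin t * poly (?U (Suc m)) ?x) - 4 * (sin t * poly (?U m) ?x)"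
      using 3 by (simp add: algebra_simps)
    moreover have "sin t * poly (?U (Suc m)) ?x = - 2 * (-2) ^ m * sin (real (m + 2) * t)"
      using less.IH[of "Suc m"] 3 by simp
    moreover have "sin t * poly (?U m) ?x = (-2) ^ m * sin (real (m + 1) * t)"
      using less.IH[of m] 3 by simp
    ultimately have "sin t * poly (?U n) ?x = - 4 * cos t * (- 2 * (-2) ^ m * sin (real (m + 2) * t)) -
        4 * ((-2) ^ m * sin (real (m + 1) * t))"
      by (simp only:)
    also have "\<dots> = 4 * (-2) ^ m * (2 * cos t * sin (real (m + 2) * t) - sin (real (m + 1) * t))"
      by (simp add: algebra_simps)
    also have "2 * cos t * sin (real (m + 2) * t) - sin (real (m + 1) * t) = sin (real (n + 1) * t)"
      using \<open>sin (real (n + 1) * t) + _ = _\<close> by simp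
    finally show ?thesis using 3 by simp
  qed
qed

lemma sin_mult_path_poly_end:
  "sin t * poly (path_poly [:-2, 1:] n) (4 - 4 * cos t) =
     (-2) ^ n * (sin (real (n + 1) * t) - sin (real n * t))"
proof (cases n)
  case (Suc m)
  thus ?thesis using sin_mult_path_poly[of t n] sin_mult_path_poly[of t m]
    by (simp add: path_poly_end_eq algebra_simps del: path_poly.simps)
qed simp

text \<open>The eigenvalue 0 corresponds to \<open>t = 0\<close>, where \<open>sin t\<close>
  vanishes and the trigonometric identities say nothing.\<close>

lemma path_poly_at_0:
  "poly (path_poly [:-2, 1:] n) 0 = (-2) ^ n"
proof (induction n rule: less_induct)
  case (less n)
  consider "n = 0" | "n = Suc 0" | m where "n = Suc (Suc m)"
    by (metis not0_implies_Suc)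
  thus ?case
    by cases (use less.IH in auto)
qed

lemma inj_on_4_minus_4cos:
  assumes "inj_on g I" "\<And>i. i \<in> I \<Longrightarrow> 0 \<le> g i \<and> g i \<le> pi"
  shows "inj_on (\<lambda>i. 4 - 4 * cos (g i)) I"
  using assms by (auto simp: inj_on_def intro!: cos_inj_pi)

text \<open>The roots come from the zeros of \<open>sin ((n + 1) * t)\<close> strictly between 0 and
  \<open>pi\<close>, where \<open>sin t\<close> can be cancelled.\<close>

lemma path_poly_interior_factor:
  "path_poly [:-4, 1:] n = (\<Prod>j\<in>{1..n}. [:- (4 - 4 * cos (real j * pi / real (n + 1))), 1:])"
proof (rule monic_eq_prod_roots)
  have b: "0 < real j * pi / real (n + 1)" "real j * pi / real (n + 1) < pi" if "j \<in> {1..n}" for j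
    using that pi_gt_zero by (auto simp: divide_less_eq)
  show "inj_on (\<lambda>j. 4 - 4 * cos (real j * pi / real (n + 1))) {1..n}"
    by (rule inj_on_4_minus_4cos) (use b in \<open>auto simp: inj_on_def less_imp_le\<close>)
  show "poly (path_poly [:-4, 1:] n) (4 - 4 * cos (real j * pi / real (n + 1))) = 0"
    if "j \<in> {1..n}" for j
  proof -
    let ?t = "real j * pi / real (n + 1)"
    have "real (n + 1) * ?t = real j * pi" by simp
    hence "sin (real (n + 1) * ?t) = 0" by simp
    with sin_mult_path_poly[of ?t n] sin_gt_zero[OF b[OF that]] show ?thesis by simp
  qed
qed (use degree_path_poly[of "[:-4, 1:]" n] in auto)

text \<open>By sum-to-product, \<open>sin ((n + 1) * t) - sin (n * t)\<close> has the factor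
  \<open>cos ((2 * n + 1) * t / 2)\<close>, which vanishes at the stated angles.\<close>

lemma path_poly_end_factor:
  "path_poly [:-2, 1:] n =
     (\<Prod>j<n. [:- (4 - 4 * cos (pi * real (2 * j + 1) / real (2 * n + 1))), 1:])"
proof (rule monic_eq_prod_roots)
  have b: "0 < pi * real (2 * j + 1) / real (2 * n + 1)" "pi * real (2 * j + 1) / real (2 * n + 1) < pi"
    if "j \<in> {..<n}" for j
    using that pi_gt_zero by (auto simp: divide_less_eq)
  show "inj_on (\<lambda>j. 4 - 4 * cos (pi * real (2 * j + 1) / real (2 * n + 1))) {..<n}"
    by (rule inj_on_4_minus_4cos) (use b in \<open>auto simp: inj_on_def less_imp_le field_simps\<close>)
  show "poly (path_poly [:-2, 1:] n) (4 - 4 * cos (pi * real (2 * j + 1) / real (2 * n + 1))) = 0"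
    if "j \<in> {..<n}" for j
  proof -
    let ?t = "pi * real (2 * j + 1) / real (2 * n + 1)"
    have "real (n + 1) * t + real n * t = real (2 * n + 1) * t" for t :: real
      by (simp add: algebra_simps)
    moreover have "real (2 * n + 1) * ?t = pi * real (2 * j + 1)" by simp
    ultimately have "(real (n + 1) * ?t + real n * ?t) / 2 = pi * real (2 * j + 1) / 2"
      by (simp only:)
    also have "cos \<dots> = 0"
      unfolding cos_zero_iff by (intro disjI1 exI[of _ "2 * j + 1"]) auto
    finally have "sin (real (n + 1) * ?t) - sin (real n * ?t) = 0"
      by (simp add: sin_diff_sin)
    with sin_mult_path_poly_end[of ?t n] sin_gt_zero[OF b[OF that]] show ?thesis by simp
  qed
qed (use degree_path_poly[of "[:-2, 1:]" n] in auto)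

text \<open>After multiplication by \<open>sin t\<close> the left side becomes
  \<open>(-2) ^ (k + 1) * (2 * cos t - 2) * sin ((k + 1) * t)\<close>. The angle 0 is a further
  root, treated separately.\<close>

lemma path_poly_whole_factor:
  "path_poly [:-2, 1:] (Suc k) + 2 * path_poly [:-2, 1:] k =
     (\<Prod>j<k + 1. [:- (4 - 4 * cos (pi * real j / real (k + 1))), 1:])"
proof (rule monic_eq_prod_roots)
  let ?E = "path_poly [:-2, 1:]"
  have b: "0 \<le> pi * real j / real (k + 1)" "pi * real j / real (k + 1) < pi" if "j \<in> {..<k + 1}" for j
    using that pi_gt_zero by (auto simp: divide_less_eq)
  show "inj_on (\<lambda>j. 4 - 4 * cos (pi * real j / real (k + 1))) {..<k + 1}"
    by (rule inj_on_4_minus_4cos) (use b in \<open>auto simp: inj_on_def less_imp_le field_simps\<close>)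
  have lt: "degree (2 * ?E k) < degree (?E (Suc k))"
    using degree_path_poly[of "[:-2, 1:]"] by (simp add: numeral_poly del: path_poly.simps)
  show "degree (?E (Suc k) + 2 * ?E k) = card {..<k + 1}"
    unfolding degree_add_eq_left[OF lt] using degree_path_poly[of "[:-2, 1:]" "Suc k"] by simp
  show "lead_coeff (?E (Suc k) + 2 * ?E k) = 1"
    unfolding add.commute[of "?E (Suc k)"] lead_coeff_add_le[OF lt]
    using degree_path_poly[of "[:-2, 1:]" "Suc k"] by (auto simp del: path_poly.simps)
  show "poly (?E (Suc k) + 2 * ?E k) (4 - 4 * cos (pi * real j / real (k + 1))) = 0"
    if j: "j \<in> {..<k + 1}" for j
  proof (cases "j = 0")
    case True
    thus ?thesis by (simp add: path_poly_at_0 del: path_poly.simps)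
  next
    case False
    let ?t = "pi * real j / real (k + 1)"
    have t: "real (k + 1) * ?t = real j * pi" by simp
    have s: "sin (real (k + 1) * ?t) = 0" unfolding t by simp
    have "sin (real (k + 2) * ?t) + sin (real k * ?t) = 2 * cos ?t * sin (real (k + 1) * ?t)"
      by (rule sin_three_term)
    with s have s': "sin (real (k + 2) * ?t) = - sin (real k * ?t)" by simp
    have "sin ?t * poly (?E (Suc k) + 2 * ?E k) (4 - 4 * cos ?t) =
      sin ?t * poly (?E (Suc k)) (4 - 4 * cos ?t) + 2 * (sin ?t * poly (?E k) (4 - 4 * cos ?t))"
      by (simp add: algebra_simps del: path_poly.simps)
    also have "\<dots> = 0"
      unfolding sin_mult_path_poly_end using s s' by (simp add: algebra_simps)
    finally show ?thesis using sin_gt_zero[of ?t] b[OF j] False by simp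
  qed
qed simp_all

section \<open>Tridiagonal and block diagonal determinants\<close>

definition tridiag_mat :: "nat \<Rightarrow> (nat \<Rightarrow> 'a) \<Rightarrow> (nat \<Rightarrow> 'a) \<Rightarrow> 'a :: zero mat" where
  "tridiag_mat n d e = mat n n (\<lambda>(i, j).
     if i = j then d i else if j = Suc i then e i else if i = Suc j then e j else 0)"

fun continuant :: "(nat \<Rightarrow> 'a) \<Rightarrow> (nat \<Rightarrow> 'a) \<Rightarrow> nat \<Rightarrow> 'a :: comm_ring_1" where
  "continuant d e 0 = 1"
| "continuant d e (Suc 0) = d 0"
| "continuant d e (Suc (Suc n)) = d (Suc n) * continuant d e (Suc n) - e n * e n * continuant d e n"

lemma tridiag_mat_carrier [simp]: "tridiag_mat n d e \<in> carrier_mat n n"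
  by (simp add: tridiag_mat_def)

text \<open>Expansion along the last row leaves two minors. The one belonging to the off-diagonal
  entry, \<open>?N\<close>, has \<open>e n\<close> as the only possibly nonzero entry of its last
  column.\<close>

lemma det_tridiag_mat_Suc_Suc:
  fixes d e :: "nat \<Rightarrow> 'a :: comm_ring_1"
  shows "det (tridiag_mat (Suc (Suc n)) d e) =
    d (Suc n) * det (tridiag_mat (Suc n) d e) - e n * e n * det (tridiag_mat n d e)"
proof -
  let ?A = "tridiag_mat (Suc (Suc n)) d e"
  let ?N = "mat_delete ?A (Suc n) n"
  have N: "?N \<in> carrier_mat (Suc n) (Suc n)"
    by (simp add: mat_delete_def tridiag_mat_def)
  have "det ?N = (\<Sum>i<Suc n. ?N $$ (i, n) * cofactor ?N i n)"
    by (rule laplace_expansion_column[OF N]) simp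
  also have "\<dots> = (\<Sum>i<Suc n. if i = n then e n * cofactor ?N i n else 0)"
    by (rule sum.cong) (auto simp: mat_delete_def tridiag_mat_def)
  also have "\<dots> = e n * det (mat_delete ?N n n)"
    by (simp add: cofactor_def)
  also have "mat_delete ?N n n = tridiag_mat n d e"
    by (rule eq_matI) (auto simp: mat_delete_def tridiag_mat_def)
  finally have detN: "det ?N = e n * det (tridiag_mat n d e)" .
  have del: "mat_delete ?A (Suc n) (Suc n) = tridiag_mat (Suc n) d e"
    by (rule eq_matI) (auto simp: mat_delete_def tridiag_mat_def)
  have "det ?A = (\<Sum>j<Suc (Suc n). ?A $$ (Suc n, j) * cofactor ?A (Suc n) j)"
    by (rule laplace_expansion_row) auto
  also have "\<dots> = e n * cofactor ?A (Suc n) n + d (Suc n) * cofactor ?A (Suc n) (Suc n)"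
    by (simp add: tridiag_mat_def)
  also have "cofactor ?A (Suc n) n = - (e n * det (tridiag_mat n d e))"
    by (simp add: cofactor_def detN)
  also have "cofactor ?A (Suc n) (Suc n) = det (tridiag_mat (Suc n) d e)"
    by (simp add: cofactor_def del power_add[symmetric])
  finally show ?thesis by (simp add: algebra_simps)
qed

lemma det_tridiag_mat: "det (tridiag_mat n d e) = continuant d e n"
proof (induction n rule: less_induct)
  case (less n)
  consider "n = 0" | "n = Suc 0" | m where "n = Suc (Suc m)"
    by (metis not0_implies_Suc)
  thus ?case
  proof cases
    case 1 thus ?thesis by (simp add: det_dim_zero)
  next
    case 2 thus ?thesis by (simp add: det_single tridiag_mat_def)
  next
    case 3 thus ?thesis using less.IH by (simp add: det_tridiag_mat_Suc_Suc)
  qed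
qed

section \<open>Characteristic polynomial of a single frequency block\<close>

lemma char_poly_tridiag_mat:
  "char_poly (tridiag_mat n d e) = continuant (\<lambda>i. [:- d i, 1:]) (\<lambda>i. [:- e i:]) n"
proof -
  have "char_poly_matrix (tridiag_mat n d e) = tridiag_mat n (\<lambda>i. [:- d i, 1:]) (\<lambda>i. [:- e i:])"
    by (rule eq_matI) (auto simp: char_poly_matrix_def tridiag_mat_def)
  thus ?thesis by (simp add: char_poly_def det_tridiag_mat)
qed

lemma continuant_cong:
  assumes "\<And>i. i < n \<Longrightarrow> d i = d' i" "\<And>i. Suc i < n \<Longrightarrow> e i = e' i"
  shows "continuant d e n = continuant d' e' n"
  using assms by (induction d e n rule: continuant.induct) auto

text \<open>Scanning invariant: after \<open>j + 1\<close> columns, with bits below \<open>j\<close>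
  consumed, \<open>C\<close> collects the finished runs and the current run has length
  \<open>i\<close>. The two hypotheses carry the pair of values that the three-term recurrence
  needs.\<close>

lemma continuant_eq_segment_poly:
  fixes s :: nat
  defines "d \<equiv> (\<lambda>c :: nat. if c = 0 then [:-2, 1:] else [:-4, 1 :: real:])"
    and "e \<equiv> (\<lambda>c. if bit s c then 0 else [:2 :: real:])"
  assumes "i \<ge> 1"
    and "continuant d e (Suc j) = C * path_poly p i" "continuant d e j = C * path_poly p (i - 1)"
  shows "continuant d e (Suc (j + n)) + 2 * continuant d e (j + n) =
    C * segment_poly p n i (s div 2 ^ j)"
  using assms(3-)
proof (induction n arbitrary: i j C p)
  case 0
  thus ?case by (simp add: algebra_simps)
next
  case (Suc n)
  have bit: "bit s j \<longleftrightarrow> odd (s div 2 ^ j)" by (simp add: bit_iff_odd)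
  have div: "s div 2 ^ j div 2 = s div 2 ^ Suc j" by (metis div_mult2_eq power_Suc2)
  obtain i' where i: "i = Suc i'" using Suc.prems(1) by (cases i) auto
  have step: "continuant d e (Suc (Suc j)) =
      [:-4, 1:] * (C * path_poly p i) - e j * e j * (C * path_poly p (i - 1))"
    using Suc.prems(2,3) by (simp add: d_def)
  show ?case
  proof (cases "bit s j")
    case True
    \<comment> \<open>A cut makes the coupling zero, so the finished run moves into \<open>C\<close>
      and a run of length 1 begins.\<close>
    have "continuant d e (Suc (Suc j)) = (C * path_poly p i) * path_poly [:-4, 1:] 1"
      unfolding step by (simp add: e_def True)
    moreover have "continuant d e (Suc j) = (C * path_poly p i) * path_poly [:-4, 1:] (1 - 1)"
      using Suc.prems by simp
    ultimately have "continuant d e (Suc (Suc j + n)) + 2 * continuant d e (Suc j + n) =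
        (C * path_poly p i) * segment_poly [:-4, 1:] n 1 (s div 2 ^ Suc j)"
      by (intro Suc.IH) simp
    thus ?thesis using True bit div by (simp add: mult.assoc)
  next
    case False
    have "e j * e j = 4" by (simp add: e_def False numeral_poly)
    hence "continuant d e (Suc (Suc j)) = C * path_poly p (Suc i)"
      unfolding step i by (simp add: algebra_simps)
    moreover have "continuant d e (Suc j) = C * path_poly p (Suc i - 1)"
      using Suc.prems by simp
    ultimately have "continuant d e (Suc (Suc j + n)) + 2 * continuant d e (Suc j + n) =
        C * segment_poly p n (Suc i) (s div 2 ^ Suc j)"
      by (intro Suc.IH) simp
    thus ?thesis using False bit div by simp
  qed
qed

text \<open>Vertex degree in column \<open>c\<close> for positive \<open>k\<close>; the single
  vertex of the graph for \<open>k = 0\<close> has degree 0.\<close>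

definition bf_diag :: "nat \<Rightarrow> nat \<Rightarrow> real" where
  "bf_diag k c = (if c = 0 \<or> c = k then 2 else 4)"

text \<open>The straight and the flipped edge contribute 1 and the sign of bit \<open>c\<close> of
  \<open>s\<close>; the Laplacian negates their sum.\<close>

definition bf_coupling :: "nat \<Rightarrow> nat \<Rightarrow> real" where
  "bf_coupling s c = (if bit s c then 0 else -2)"

lemma char_poly_bf_block:
  assumes "k \<ge> 1"
  shows "char_poly (tridiag_mat (k + 1) (bf_diag k) (bf_coupling s)) = segment_poly [:-2, 1:] k 1 s"
proof -
  define d :: "nat \<Rightarrow> real poly" where "d c = (if c = 0 then [:-2, 1:] else [:-4, 1:])" for c
  define e :: "nat \<Rightarrow> real poly" where "e c = (if bit s c then 0 else [:2:])" for c
  let ?d = "\<lambda>c. [:- bf_diag k c, 1:]" and ?e = "\<lambda>c. [:- bf_coupling s c:]"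
  obtain m where m: "k = Suc m" using assms by (cases k) auto
  have e: "?e = e" by (auto simp: e_def bf_coupling_def)
  have c: "continuant ?d e n = continuant d e n" if "n \<le> k" for n
    by (rule continuant_cong) (use that in \<open>auto simp: d_def bf_diag_def\<close>)
  have "continuant ?d e (Suc k) = [:-2, 1:] * continuant d e k - e m * e m * continuant d e m"
    using c[of k] c[of m] m by (simp add: bf_diag_def)
  \<comment> \<open>The last column has degree 2, while \<open>d\<close> continues with 4; the
    difference produces the term \<open>2 * continuant d e k\<close>.\<close>
  also have "[:-2, 1:] = d k + [:2:]" using m by (simp add: d_def)
  also have "(d k + [:2:]) * continuant d e k - e m * e m * continuant d e m =
      continuant d e (Suc k) + 2 * continuant d e k"
    using m by (simp add: algebra_simps numeral_poly)
  also have "\<dots> = segment_poly [:-2, 1:] k 1 s"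
    using continuant_eq_segment_poly[of 1 s 0 1 "[:-2, 1:]" k]
    by (simp add: d_def[abs_def] e_def[abs_def])
  finally show ?thesis by (simp add: char_poly_tridiag_mat e)
qed

section \<open>Two-level indices and block diagonal matrices\<close>

lemma sum_lessThan_mult_div_mod:
  fixes f :: "nat \<Rightarrow> nat \<Rightarrow> 'a :: comm_monoid_add"
  shows "(\<Sum>l<m * n. f (l div n) (l mod n)) = (\<Sum>a<m. \<Sum>b<n. f a b)"
proof -
  have "(\<Sum>l<m * n. f (l div n) (l mod n)) = (\<Sum>(a, b)\<in>{..<m} \<times> {..<n}. f a b)"
  proof (rule sum.reindex_bij_witness[where j = "\<lambda>l. (l div n, l mod n)" and i = "\<lambda>(a, b). a * n + b"])
    fix x assume x: "x \<in> {..<m} \<times> {..<n}"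
    obtain a b where ab: "x = (a, b)" "a < m" "b < n" using x by auto
    have "a * n + b < Suc a * n" using ab by simp
    also have "\<dots> \<le> m * n" using ab by (intro mult_le_mono1) simp
    finally show "(case x of (a, b) \<Rightarrow> a * n + b) \<in> {..<m * n}" using ab by simp
    show "((case x of (a, b) \<Rightarrow> a * n + b) div n, (case x of (a, b) \<Rightarrow> a * n + b) mod n) = x"
      using ab by simp
  next
    fix l assume l: "l \<in> {..<m * n}"
    hence "n > 0" by (cases n) auto
    thus "(l div n, l mod n) \<in> {..<m} \<times> {..<n}"
      using l by (simp add: less_mult_imp_div_less)
  qed auto
  thus ?thesis by (simp add: sum.cartesian_product)
qed

definition block_diag :: "nat \<Rightarrow> nat \<Rightarrow> (nat \<Rightarrow> 'a mat) \<Rightarrow> 'a :: zero mat" where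
  "block_diag m n B = mat (m * n) (m * n)
     (\<lambda>(i, j). if i div n = j div n then B (i div n) $$ (i mod n, j mod n) else 0)"

text \<open>Splitting off the last block gives a two by two block matrix with zero off-diagonal
  blocks.\<close>

lemma det_block_diag:
  fixes B :: "nat \<Rightarrow> 'a :: idom mat"
  assumes "\<And>b. b < m \<Longrightarrow> B b \<in> carrier_mat n n"
  shows "det (block_diag m n B) = (\<Prod>b<m. det (B b))"
  using assms
proof (induction m)
  case 0
  thus ?case by (simp add: block_diag_def det_dim_zero)
next
  case (Suc m)
  have B: "B m \<in> carrier_mat n n" using Suc.prems by simp
  have "block_diag (Suc m) n B = four_block_mat (block_diag m n B) (0\<^sub>m (m * n) n) (0\<^sub>m n (m * n)) (B m)"
    (is "?L = ?R")
  proof (rule eq_matI)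
    fix i j assume ij: "i < dim_row ?R" "j < dim_col ?R"
    hence n: "n > 0" using B by (cases n) (auto simp: block_diag_def)
    have upper: "a div n = m \<and> a mod n = a - m * n" if "a < Suc m * n" "\<not> a < m * n" for a
    proof -
      define r where "r = a - m * n"
      have "a = r + m * n" "r < n" using that by (auto simp: r_def)
      thus ?thesis using n by simp
    qed
    have lower: "a div n < m" if "a < m * n" for a
      using that by (simp add: less_mult_imp_div_less)
    have sz: "i < Suc m * n" "j < Suc m * n" using ij B by (auto simp: block_diag_def)
    have L: "?L $$ (i, j) = (if i div n = j div n then B (i div n) $$ (i mod n, j mod n) else 0)"
      using sz by (simp add: block_diag_def del: mult_Suc)
    have R: "?R $$ (i, j) = (if i < m * n
        then if j < m * n then block_diag m n B $$ (i, j) else 0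
        else if j < m * n then 0 else B m $$ (i - m * n, j - m * n))"
      using sz B by (simp add: block_diag_def)
    show "?L $$ (i, j) = ?R $$ (i, j)"
    proof (cases "i < m * n"; cases "j < m * n")
      assume "i < m * n" "j < m * n"
      thus ?thesis unfolding L R by (simp add: block_diag_def)
    next
      assume "i < m * n" "\<not> j < m * n"
      thus ?thesis unfolding L R using lower[of i] upper[of j] sz by auto
    next
      assume "\<not> i < m * n" "j < m * n"
      thus ?thesis unfolding L R using lower[of j] upper[of i] sz by auto
    next
      assume "\<not> i < m * n" "\<not> j < m * n"
      thus ?thesis unfolding L R using upper[of i] upper[of j] sz by simp
    qed
  qed (use B in \<open>auto simp: block_diag_def\<close>)
  also have "det \<dots> = det (block_diag m n B) * det (B m)"
    by (rule det_four_block_mat_upper_right_zero) (use B in \<open>auto simp: block_diag_def\<close>)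
  finally show ?case using Suc by simp
qed

lemma char_poly_block_diag:
  fixes B :: "nat \<Rightarrow> 'a :: idom mat"
  assumes B: "\<And>b. b < m \<Longrightarrow> B b \<in> carrier_mat n n"
  shows "char_poly (block_diag m n B) = (\<Prod>b<m. char_poly (B b))"
proof -
  have "char_poly_matrix (block_diag m n B) = block_diag m n (\<lambda>b. char_poly_matrix (B b))"
    (is "?L = ?R")
  proof (rule eq_matI)
    fix i j assume ij: "i < dim_row ?R" "j < dim_col ?R"
    hence n: "n > 0" by (cases n) (auto simp: block_diag_def)
    have "i div n < m" using ij by (simp add: block_diag_def less_mult_imp_div_less)
    note Bi = B[OF this]
    have "i = j \<longleftrightarrow> i div n = j div n \<and> i mod n = j mod n"
      by (metis div_mult_mod_eq)
    thus "?L $$ (i, j) = ?R $$ (i, j)"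
      using ij n Bi by (auto simp: block_diag_def char_poly_matrix_def)
  qed (auto simp: block_diag_def char_poly_matrix_def)
  thus ?thesis unfolding char_poly_def
    by (simp add: det_block_diag[of m _ n] B)
qed

section \<open>Walsh transform of the Laplacian\<close>

fun walsh :: "nat \<Rightarrow> nat \<Rightarrow> nat \<Rightarrow> real" where
  "walsh 0 s w = 1"
| "walsh (Suc k) s w = (if odd s \<and> odd w then -1 else 1) * walsh k (s div 2) (w div 2)"

lemma walsh_orthogonal:
  assumes "s < 2 ^ k" "t < 2 ^ k"
  shows "(\<Sum>w<2 ^ k. walsh k s w * walsh k t w) = (if s = t then 2 ^ k else 0)"
  using assms
proof (induction k arbitrary: s t)
  case 0
  thus ?case by simp
next
  case (Suc k)
  \<comment> \<open>Sum over the lowest bit of \<open>w\<close>: it is 2 if the lowest bits of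
    \<open>s\<close> and \<open>t\<close> agree and 0 otherwise.\<close>
  let ?c = "1 + (if odd s then -1 else 1) * (if odd t then -1 else 1 :: real)"
  have "(\<Sum>w<2 ^ Suc k. walsh (Suc k) s w * walsh (Suc k) t w) =
      (\<Sum>w<2 ^ k. ?c * (walsh k (s div 2) w * walsh k (t div 2) w))"
    unfolding sum_lessThan_power2_Suc by (intro sum.cong) (auto simp: algebra_simps)
  also have "\<dots> = ?c * (if s div 2 = t div 2 then 2 ^ k else 0)"
    unfolding sum_distrib_left[symmetric] using Suc.prems by (subst Suc.IH) auto
  also have "\<dots> = (if s = t then 2 ^ Suc k else 0)"
  proof -
    have "s = t \<longleftrightarrow> s div 2 = t div 2 \<and> (even s \<longleftrightarrow> even t)"
      by (metis bit_eq_rec)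
    thus ?thesis by auto
  qed
  finally show ?case .
qed

text \<open>Characters are eigenvectors of bit flips. This is why the edges between two columns act
  on each frequency as a scalar.\<close>

lemma walsh_flip_bit:
  "c < k \<Longrightarrow> walsh k s (flip_bit c w) = (if bit s c then -1 else 1) * walsh k s w"
proof (induction k arbitrary: s w c)
  case (Suc k)
  show ?case
  proof (cases c)
    case 0
    thus ?thesis by (auto simp: flip_bit_0 bit_0)
  next
    case (Suc c')
    have "(w mod 2 + 2 * flip_bit c' (w div 2)) div 2 = flip_bit c' (w div 2)" by simp
    moreover have "odd (w mod 2 + 2 * flip_bit c' (w div 2)) \<longleftrightarrow> odd w" by simp
    ultimately show ?thesis using Suc Suc.IH[of c' "s div 2" "w div 2"] Suc.prems
      by (simp add: flip_bit_Suc bit_Suc)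
  qed
qed simp

section \<open>Action of the adjacency matrix, column by column\<close>

lemma flip_bit_nat_less:
  fixes w :: nat
  assumes "w < 2 ^ k" "c < k"
  shows "flip_bit c w < 2 ^ k"
proof -
  have "take_bit k (flip_bit c w) = flip_bit c w"
    using assms by (simp add: take_bit_flip_bit_eq take_bit_nat_eq_self)
  thus ?thesis by (simp add: take_bit_nat_eq_self_iff)
qed

lemma flip_bit_neq: "flip_bit c w \<noteq> (w :: nat)"
  by (metis bit_flip_bit_iff possible_bit_nat)

lemma flip_bit_flip_bit: "flip_bit c (flip_bit c w) = (w :: nat)"
  by (rule bit_eqI) (auto simp: bit_flip_bit_iff)

text \<open>A neighbouring column contains exactly two neighbours, distinct because a flip moves
  every word. The flipped bit is indexed by the smaller of the two columns, and since flips are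
  involutions both directions give the same pair.\<close>

lemma sum_bf_adj:
  fixes g :: "nat \<Rightarrow> real"
  assumes "c \<le> k" "c' \<le> k" "w < 2 ^ k"
  shows "(\<Sum>w'<2 ^ k. if bf_adj k (c, w) (c', w') then g w' else 0) =
    (if c' = Suc c then g w + g (flip_bit c w)
     else if c = Suc c' then g w + g (flip_bit c' w) else 0)"
proof -
  have pair: "(\<Sum>w'<2 ^ k. if w' = w \<or> w' = flip_bit b w then g w' else 0) = g w + g (flip_bit b w)"
    if "b < k" for b
  proof -
    have "(\<Sum>w'<2 ^ k. if w' = w \<or> w' = flip_bit b w then g w' else 0) = sum g {w, flip_bit b w}"
      using assms(3) flip_bit_nat_less[OF assms(3) that]
      by (intro sum.mono_neutral_cong_right) auto
    thus ?thesis using flip_bit_neq[of b w] by simp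
  qed
  consider "c' = Suc c" | "c = Suc c'" | "c' \<noteq> Suc c" "c \<noteq> Suc c'" by blast
  thus ?thesis
  proof cases
    case 1
    have "(\<Sum>w'<2 ^ k. if bf_adj k (c, w) (c', w') then g w' else 0) =
        (\<Sum>w'<2 ^ k. if w' = w \<or> w' = flip_bit c w then g w' else 0)"
      using 1 assms by (intro sum.cong) (auto simp: bf_adj_def)
    thus ?thesis using pair[of c] 1 assms by simp
  next
    case 2
    have adj: "bf_adj k (c, w) (c', w') \<longleftrightarrow> w' = w \<or> w' = flip_bit c' w" if "w' < 2 ^ k" for w'
    proof -
      have "bf_adj k (c, w) (c', w') \<longleftrightarrow> w = w' \<or> w = flip_bit c' w'"
        using 2 assms that by (simp add: bf_adj_def)
      also have "\<dots> \<longleftrightarrow> w' = w \<or> w' = flip_bit c' w"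
        by (metis flip_bit_flip_bit)
      finally show ?thesis .
    qed
    have "(\<Sum>w'<2 ^ k. if bf_adj k (c, w) (c', w') then g w' else 0) =
        (\<Sum>w'<2 ^ k. if w' = w \<or> w' = flip_bit c' w then g w' else 0)"
      by (intro sum.cong) (auto simp: adj)
    thus ?thesis using pair[of c'] 2 assms by simp
  next
    case 3
    thus ?thesis by (simp add: bf_adj_def)
  qed
qed

text \<open>Used twice: with \<open>g\<close> constantly 1 for the degrees, and with
  \<open>g\<close> a column of \<open>walsh_mat\<close> for the action on characters.\<close>

lemma sum_bf_adj_mat:
  fixes g :: "nat \<Rightarrow> nat \<Rightarrow> real"
  assumes "i < bf_size k"
  defines "c \<equiv> i div 2 ^ k" and "w \<equiv> i mod 2 ^ k"
  shows "(\<Sum>l<bf_size k. bf_adj_mat k $$ (i, l) * g (l div 2 ^ k) (l mod 2 ^ k)) =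
    (\<Sum>c'<k + 1. if c' = Suc c then g c' w + g c' (flip_bit c w)
       else if c = Suc c' then g c' w + g c' (flip_bit c' w) else 0)"
proof -
  have c: "c \<le> k" using assms(1) less_mult_imp_div_less[of i "k + 1" "2 ^ k"]
    unfolding bf_size_def c_def by simp
  have w: "w < 2 ^ k" by (simp add: w_def)
  have "(\<Sum>l<bf_size k. bf_adj_mat k $$ (i, l) * g (l div 2 ^ k) (l mod 2 ^ k)) =
      (\<Sum>l<(k + 1) * 2 ^ k. if bf_adj k (c, w) (l div 2 ^ k, l mod 2 ^ k)
         then g (l div 2 ^ k) (l mod 2 ^ k) else 0)"
    using assms(1) unfolding bf_size_def c_def w_def
    by (intro sum.cong) (auto simp: bf_adj_mat_def bf_vertex_def bf_size_def)
  also have "\<dots> = (\<Sum>c'<k + 1. \<Sum>w'<2 ^ k. if bf_adj k (c, w) (c', w') then g c' w' else 0)"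
    by (rule sum_lessThan_mult_div_mod)
  also have "\<dots> = (\<Sum>c'<k + 1. if c' = Suc c then g c' w + g c' (flip_bit c w)
       else if c = Suc c' then g c' w + g c' (flip_bit c' w) else 0)"
    using c w by (intro sum.cong refl sum_bf_adj) auto
  finally show ?thesis .
qed

lemma bf_degree:
  assumes "k \<ge> 1" "i < bf_size k"
  shows "(\<Sum>l<bf_size k. bf_adj_mat k $$ (i, l)) = bf_diag k (i div 2 ^ k)"
proof -
  let ?c = "i div 2 ^ k"
  have c: "?c \<le> k" using assms(2) less_mult_imp_div_less[of i "k + 1" "2 ^ k"]
    unfolding bf_size_def by simp
  have "(\<Sum>l<bf_size k. bf_adj_mat k $$ (i, l)) =
      (\<Sum>c'<k + 1. if c' = Suc ?c then 2 else if ?c = Suc c' then 2 else 0)"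
    using sum_bf_adj_mat[OF assms(2), of "\<lambda>_ _. 1"] by (simp cong: if_cong)
  \<comment> \<open>The guard \<open>?c \<noteq> 0\<close> excludes the truncated value of
    \<open>?c - 1\<close> at column 0.\<close>
  also have "\<dots> = (\<Sum>c'<k + 1. (if c' = Suc ?c then 2 else 0) + (if ?c \<noteq> 0 \<and> c' = ?c - 1 then 2 else 0))"
    by (intro sum.cong) auto
  also have "\<dots> = (if ?c < k then 2 else 0) + (if ?c \<noteq> 0 then 2 else 0)"
    using c by (auto simp: sum.distrib)
  also have "\<dots> = bf_diag k ?c"
    using c assms(1) by (auto simp: bf_diag_def)
  finally show ?thesis .
qed

text \<open>Rows are indexed by vertices \<open>c * 2 ^ k + w\<close>, columns by \<open>s * (k + 1) + c\<close>, so that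
  conjugation also sorts the coordinates by frequency.\<close>

definition walsh_mat :: "nat \<Rightarrow> real mat" where
  "walsh_mat k = mat (bf_size k) (bf_size k) (\<lambda>(i, j).
     if i div 2 ^ k = j mod (k + 1) then walsh k (j div (k + 1)) (i mod 2 ^ k) else 0)"

lemma walsh_mat_transpose_mult:
  "transpose_mat (walsh_mat k) * walsh_mat k = 2 ^ k \<cdot>\<^sub>m 1\<^sub>m (bf_size k)" (is "?L = ?R")
proof (rule eq_matI)
  fix i j assume "i < dim_row ?R" "j < dim_col ?R"
  hence ij: "i < bf_size k" "j < bf_size k" by auto
  define s t a b where "s = i div (k + 1)" and "t = j div (k + 1)"
    and "a = i mod (k + 1)" and "b = j mod (k + 1)"
  have st: "s < 2 ^ k" "t < 2 ^ k"
    using ij by (auto simp: s_def t_def bf_size_def mult.commute intro!: less_mult_imp_div_less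
        simp del: mult_Suc mult_Suc_right)
  have a: "a < k + 1" unfolding a_def by simp
  have "?L $$ (i, j) = (\<Sum>l<bf_size k. walsh_mat k $$ (l, i) * walsh_mat k $$ (l, j))"
    using ij by (simp add: walsh_mat_def scalar_prod_def lessThan_atLeast0)
  also have "\<dots> = (\<Sum>l<(k + 1) * 2 ^ k. if l div 2 ^ k = a \<and> l div 2 ^ k = b
      then walsh k s (l mod 2 ^ k) * walsh k t (l mod 2 ^ k) else 0)"
    unfolding bf_size_def[symmetric] using ij by (intro sum.cong) (auto simp: walsh_mat_def s_def t_def a_def b_def)
  also have "\<dots> = (\<Sum>c<k + 1. \<Sum>w<2 ^ k. if c = a \<and> c = b
      then walsh k s w * walsh k t w else 0)"
    by (rule sum_lessThan_mult_div_mod)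
  also have "\<dots> = (\<Sum>c<k + 1. if c = a then if a = b \<and> s = t then 2 ^ k else 0 else 0)"
    using walsh_orthogonal[OF st] by (intro sum.cong refl) (cases "a = b"; auto)
  also have "\<dots> = (if a = b \<and> s = t then 2 ^ k else 0)"
    using a by simp
  also have "a = b \<and> s = t \<longleftrightarrow> i = j"
    unfolding s_def t_def a_def b_def by (metis div_mult_mod_eq)
  finally show "?L $$ (i, j) = ?R $$ (i, j)" using ij by simp
qed (auto simp: walsh_mat_def)

text \<open>The intertwining form needs no inverse: at vertex \<open>(c, w)\<close> and index
  \<open>(s, c')\<close> both sides equal \<open>walsh k s w\<close> times the entry
  \<open>(c, c')\<close> of the block for \<open>s\<close>.\<close>

lemma bf_laplacian_mult_walsh_mat:
  assumes "k \<ge> 1"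
  shows "bf_laplacian k * walsh_mat k =
    walsh_mat k * block_diag (2 ^ k) (k + 1) (\<lambda>s. tridiag_mat (k + 1) (bf_diag k) (bf_coupling s))"
    (is "?L = walsh_mat k * ?M")
proof (rule eq_matI)
  have M: "?M \<in> carrier_mat (bf_size k) (bf_size k)"
    by (simp add: block_diag_def bf_size_def mult.commute)
  let ?R = "walsh_mat k * ?M"
  fix i j assume "i < dim_row ?R" "j < dim_col ?R"
  hence ij: "i < bf_size k" "j < bf_size k" using M by (auto simp: walsh_mat_def)
  define c w s c' where "c = i div 2 ^ k" and "w = i mod 2 ^ k" and "s = j div (k + 1)"
    and "c' = j mod (k + 1)"
  have c: "c \<le> k" using ij(1) less_mult_imp_div_less[of i "k + 1" "2 ^ k"]
    unfolding bf_size_def c_def by simp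
  have c': "c' \<le> k" using mod_less_divisor[of "k + 1" j] unfolding c'_def by linarith
  have s: "s < 2 ^ k" using ij(2) less_mult_imp_div_less[of j "2 ^ k" "k + 1"]
    unfolding bf_size_def s_def by (simp add: mult.commute)
  have Wl: "walsh_mat k $$ (l, j) = (if l div 2 ^ k = c' then walsh k s (l mod 2 ^ k) else 0)"
    if "l < bf_size k" for l
    using that ij by (simp add: walsh_mat_def c'_def s_def)
  \<comment> \<open>Column \<open>j\<close> of \<open>walsh_mat k\<close>, viewed as a function on
    vertices: one character supported on one column of the graph.\<close>
  define g where "g c'' w'' = (if c'' = c' then walsh k s w'' else 0)" for c'' w''
  have "?L $$ (i, j) = (\<Sum>l<bf_size k. bf_laplacian k $$ (i, l) * walsh_mat k $$ (l, j))"
    using ij by (simp add: walsh_mat_def scalar_prod_def lessThan_atLeast0 bf_laplacian_def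
        bf_adj_mat_def bf_deg_mat_def)
  also have "\<dots> = (\<Sum>l<bf_size k. (if l = i then bf_diag k c * walsh_mat k $$ (l, j) else 0) -
      bf_adj_mat k $$ (i, l) * walsh_mat k $$ (l, j))"
    using ij bf_degree[OF assms ij(1)]
    by (intro sum.cong refl)
      (auto simp: bf_laplacian_def bf_deg_mat_def bf_adj_mat_def c_def left_diff_distrib)
  also have "\<dots> = bf_diag k c * walsh_mat k $$ (i, j) -
      (\<Sum>l<bf_size k. bf_adj_mat k $$ (i, l) * walsh_mat k $$ (l, j))"
    using ij by (simp add: sum_subtractf)
  also have "(\<Sum>l<bf_size k. bf_adj_mat k $$ (i, l) * walsh_mat k $$ (l, j)) =
      (\<Sum>l<bf_size k. bf_adj_mat k $$ (i, l) * g (l div 2 ^ k) (l mod 2 ^ k))"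
    by (intro sum.cong refl) (simp add: Wl g_def)
  also have "\<dots> = (\<Sum>c''<k + 1. if c'' = Suc c then g c'' w + g c'' (flip_bit c w)
       else if c = Suc c'' then g c'' w + g c'' (flip_bit c'' w) else 0)"
    unfolding c_def w_def by (rule sum_bf_adj_mat[OF ij(1)])
  also have "\<dots> = (\<Sum>c''<k + 1. if c'' = c' then
      (if c' = Suc c then walsh k s w + walsh k s (flip_bit c w)
       else if c = Suc c' then walsh k s w + walsh k s (flip_bit c' w) else 0) else 0)"
    by (intro sum.cong refl) (auto simp: g_def)
  also have "\<dots> = (if c' = Suc c then - bf_coupling s c
       else if c = Suc c' then - bf_coupling s c' else 0) * walsh k s w"
    using c c' by (auto simp: walsh_flip_bit bf_coupling_def simp del: walsh.simps)
  also have "bf_diag k c * walsh_mat k $$ (i, j) - \<dots> =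
      walsh k s w * tridiag_mat (k + 1) (bf_diag k) (bf_coupling s) $$ (c, c')"
    using Wl[OF ij(1)] c c' by (auto simp: tridiag_mat_def c_def[symmetric] w_def[symmetric])
  finally have L: "?L $$ (i, j) = \<dots>" .
  have "?R $$ (i, j) = (\<Sum>l<bf_size k. walsh_mat k $$ (i, l) * ?M $$ (l, j))"
    using ij M by (simp add: walsh_mat_def scalar_prod_def lessThan_atLeast0)
  \<comment> \<open>The first matrix forces the graph column to be \<open>c\<close>, the block
    structure forces the frequency to be \<open>s\<close>; a single index survives.\<close>
  also have "\<dots> = (\<Sum>l<2 ^ k * (k + 1). if c = l mod (k + 1) \<and> l div (k + 1) = s then walsh k s w *
      tridiag_mat (k + 1) (bf_diag k) (bf_coupling s) $$ (c, c') else 0)"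
    using ij by (intro sum.cong)
      (auto simp: walsh_mat_def block_diag_def bf_size_def mult.commute c_def w_def s_def c'_def
        simp del: mult_Suc mult_Suc_right)
  also have "\<dots> = (\<Sum>s'<2 ^ k. \<Sum>c''<k + 1. if c = c'' \<and> s' = s then walsh k s w *
      tridiag_mat (k + 1) (bf_diag k) (bf_coupling s) $$ (c, c') else 0)"
    by (rule sum_lessThan_mult_div_mod)
  also have "\<dots> = (\<Sum>s'<2 ^ k. if s' = s then walsh k s w *
      tridiag_mat (k + 1) (bf_diag k) (bf_coupling s) $$ (c, c') else 0)"
    using c by (intro sum.cong refl) auto
  also have "\<dots> = walsh k s w * tridiag_mat (k + 1) (bf_diag k) (bf_coupling s) $$ (c, c')"
    using s by simp
  finally show "?L $$ (i, j) = ?R $$ (i, j)" using L by simp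
qed (auto simp: walsh_mat_def bf_laplacian_def bf_deg_mat_def bf_adj_mat_def block_diag_def bf_size_def)

section \<open>Similarity of the Laplacian to the block diagonal matrix\<close>

lemma char_poly_bf_laplacian:
  assumes "k \<ge> 1"
  shows "char_poly (bf_laplacian k) = (\<Prod>s<2 ^ k. segment_poly [:-2, 1:] k 1 s)"
proof -
  define M where "M = block_diag (2 ^ k) (k + 1) (\<lambda>s. tridiag_mat (k + 1) (bf_diag k) (bf_coupling s))"
  define W where "W = walsh_mat k"
  define V where "V = (1 / 2 ^ k) \<cdot>\<^sub>m transpose_mat W"
  let ?n = "bf_size k"
  have carr: "bf_laplacian k \<in> carrier_mat ?n ?n" "M \<in> carrier_mat ?n ?n"
    "W \<in> carrier_mat ?n ?n" "V \<in> carrier_mat ?n ?n"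
    by (auto simp: bf_laplacian_def bf_deg_mat_def bf_adj_mat_def M_def block_diag_def W_def V_def
        walsh_mat_def bf_size_def)
  have "V * W = (1 / 2 ^ k) \<cdot>\<^sub>m (transpose_mat W * W)"
    unfolding V_def using carr(3) by (intro mult_smult_assoc_mat) auto
  also have "\<dots> = 1\<^sub>m ?n"
    unfolding W_def walsh_mat_transpose_mult by (rule eq_matI) auto
  finally have VW: "V * W = 1\<^sub>m ?n" .
  \<comment> \<open>For square matrices a one-sided inverse is two-sided.\<close>
  have WV: "W * V = 1\<^sub>m ?n" by (rule mat_mult_left_right_inverse[OF carr(4,3) VW])
  have "bf_laplacian k = bf_laplacian k * (W * V)" using WV carr by simp
  also have "\<dots> = bf_laplacian k * W * V" by (rule assoc_mult_mat[OF carr(1,3,4), symmetric])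
  also have "bf_laplacian k * W = W * M"
    unfolding W_def M_def by (rule bf_laplacian_mult_walsh_mat[OF assms])
  finally have "similar_mat_wit (bf_laplacian k) M W V"
    using carr WV VW by (auto simp: similar_mat_wit_def Let_def)
  hence "char_poly (bf_laplacian k) = char_poly M"
    by (intro char_poly_similar) (auto simp: similar_mat_def)
  also have "\<dots> = (\<Prod>s<2 ^ k. segment_poly [:-2, 1:] k 1 s)"
    unfolding M_def by (subst char_poly_block_diag) (auto simp: char_poly_bf_block[OF assms, simplified])
  finally show ?thesis .
qed

section \<open>Regrouping the factors as a multiset of eigenvalues\<close>

lemma image_mset_sum:
  "image_mset f (\<Sum>i\<in>I. F i) = (\<Sum>i\<in>I. image_mset f (F i))"
  by (induction I rule: infinite_finite_induct) auto

lemma prod_mset_sum: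
  "prod_mset (\<Sum>i\<in>I. F i) = (\<Prod>i\<in>I. prod_mset (F i))"
  by (induction I rule: infinite_finite_induct) auto

theorem theoremA1:
  fixes k :: nat
  assumes "k \<ge> 1"
  shows "char_poly (bf_laplacian k) = (\<Prod>a\<in>#bf_spectrum k. [:- a, 1:])"
proof -
  let ?U = "path_poly [:-4, 1:]" and ?E = "path_poly [:-2, 1:]"
  \<comment> \<open>Runs at the first column and their mirror images at the last one share a
    polynomial, so \<open>2 ^ (k - i)\<close> doubles to \<open>2 ^ (k - i + 1)\<close>.\<close>
  have mult_E: "(\<Prod>j<k. ?E (1 + j) ^ 2 ^ (k - 1 - j)) * (\<Prod>j<k. ?E (Suc j) ^ 2 ^ (k - 1 - j)) =
      (\<Prod>i\<in>{1..k}. ?E i ^ 2 ^ (k - i + 1))"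
    by (simp add: prod.atLeast1_atMost_eq prod.distrib[symmetric] power_add[symmetric] mult_2
        del: path_poly.simps)
  obtain m where m: "k = Suc m" using assms by (cases k) auto
  \<comment> \<open>With \<open>i = j + 1\<close>, the index \<open>i = k\<close> drops out because
    its exponent is 0.\<close>
  have mult_U: "(\<Prod>j<k. ?U (Suc j) ^ ((k - 1 - j) * 2 ^ (k - 1 - j - 1))) =
      (\<Prod>i\<in>{1..k - 1}. ?U i ^ ((k - i) * 2 ^ (k - i - 1)))"
    unfolding m by (simp add: prod.atLeast1_atMost_eq del: path_poly.simps)
  have "(\<Prod>a\<in>#bf_spectrum k. [:- a, 1:]) =
      (\<Prod>j<k + 1. [:- (4 - 4 * cos (pi * real j / real (k + 1))), 1:]) *
      (\<Prod>i\<in>{1..k}. \<Prod>j<i. [:- (4 - 4 * cos (pi * real (2 * j + 1) / real (2 * i + 1))), 1:] ^ 2 ^ (k - i + 1)) *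
      (\<Prod>i\<in>{1..k - 1}. \<Prod>j\<in>{1..i}. [:- (4 - 4 * cos (real j * pi / real (i + 1))), 1:] ^ ((k - i) * 2 ^ (k - i - 1)))"
  proof -
    have "(\<Prod>a\<in>#mset (map g [0..<n]). f a) = (\<Prod>j<n. f (g j))"
      for f :: "real \<Rightarrow> real poly" and g and n :: nat
      by (induction n) (auto simp: mult.commute)
    thus ?thesis
      unfolding bf_spectrum_def image_mset_union image_mset_sum prod_mset.union prod_mset_sum
        image_replicate_mset prod_mset_replicate_mset by simp
  qed
  also have "\<dots> = (?E (Suc k) + 2 * ?E k) * (\<Prod>i\<in>{1..k}. ?E i ^ 2 ^ (k - i + 1)) *
      (\<Prod>i\<in>{1..k - 1}. ?U i ^ ((k - i) * 2 ^ (k - i - 1)))"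
    unfolding prod_power_distrib[symmetric] path_poly_whole_factor[symmetric]
      path_poly_end_factor[symmetric] path_poly_interior_factor[symmetric] ..
  also have "\<dots> = char_poly (bf_laplacian k)"
    unfolding char_poly_bf_laplacian[OF assms] prod_segment_poly[OF order.refl]
      mult_E[symmetric] mult_U[symmetric]
    by (simp add: mult.assoc)
  finally show ?thesis ..
qed

end
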